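(* Let $\alpha\in l_1(\mathbb{Z})$ be a mask and suppose $\sup_{j\in\mathbb{N}}\|\mathcal{S}_\alpha^j\|_\infty\le K$ for some constant $K>0$. Then the reconstructed data $c^{(j)}$ at level $j$ from coarse data $c^{(0)}$ and details $d^{(1)},\ldots,d^{(j)}$ via $$c^{(\ell)}=\mathcal{S}_\alpha c^{(\ell-1)}+d^{(\ell)},\qquad \ell=1,\ldots,j,$$ is stable; that is, $$\|c^{(j)}-\tilde c^{(j)}\|_\infty\le K\left(\|c^{(0)}-\tilde c^{(0)}\|_\infty+\sum_{\ell=1}^{j}\|d^{(\ell)}-\tilde d^{(\ell)}\|_\infty\right),$$ where $\tilde c^{(j)}$ is reconstructed from the data $\tilde c^{(0)},\tilde d^{(1)},\ldots,\tilde d^{(j)}$ in the same way, i.e. via $\tilde c^{(\ell)}=\mathcal{S}_\alpha\tilde c^{(\ell-1)}+\tilde d^{(\ell)}$, $\ell=1,\ldots,j$.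
   Context: $\mathbb{N}$ denotes the positive integers, and $j\in\mathbb{N}$. Sequences are real-valued and indexed by $\mathbb{Z}$; $l_1(\mathbb{Z})$ and $l_\infty(\mathbb{Z})$ are the spaces of absolutely summable and of bounded sequences, and $\|c\|_\infty:=\sup_{k}|c_k|$. A mask is a sequence in $l_1(\mathbb{Z})$. For a mask $\alpha$ the subdivision operator $\mathcal{S}_\alpha:l_\infty(\mathbb{Z})\to l_\infty(\mathbb{Z})$ is $(\mathcal{S}_\alpha c)_k:=\sum_{\ell\in\mathbb{Z}}\alpha_{k-2\ell}c_\ell$; $\mathcal{S}_\alpha^j$ is its $j$-fold composition, and $\|\cdot\|_\infty$ applied to an operator is its operator norm on $l_\infty(\mathbb{Z})$. The coarse data $c^{(0)},\tilde c^{(0)}$ and the details $d^{(\ell)},\tilde d^{(\ell)}$ are sequences in $l_\infty(\mathbb{Z})$.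
   Formalization: The constant is required to satisfy K ≥ 1 instead of K > 0: with the supremum over positive j only, the claim fails for every K < 1 (e.g. α = 0, K = 1/2, j = 1, equal coarse data, differing d^(1)), since the last detail enters through the identity. *)

theory Defs
  imports "HOL-Analysis.Analysis"
begin

text \<open>
  The topology of \<^typ>\<open>int\<close> is discrete, so every integer-indexed sequence is continuous and the
  type of bounded continuous functions is exactly the space of bounded sequences with the
  supremum norm.
\<close>

type_synonym linf = "int \<Rightarrow>\<^sub>C real"

text \<open>
  The application of \<^const>\<open>Bcontfun\<close> and the sum are only meaningful for absolutely summable
  masks; see \<open>apply_subdivision\<close> and \<open>subdivision_summable\<close> below.
\<close>

definition subdivision :: "(int \<Rightarrow> real) \<Rightarrow> linf \<Rightarrow> linf" where
  "subdivision \<alpha> c = Bcontfun (\<lambda>k. \<Sum>\<^sub>\<infinity>l. \<alpha> (k - 2 * l) * apply_bcontfun c l)"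

lemma bcontfun_int_iff: "f \<in> bcontfun \<longleftrightarrow> bounded (range f)" for f :: "int \<Rightarrow> real"
  by (simp add: bcontfun_def)

lemma mask_subsequence:
  fixes \<alpha> :: "int \<Rightarrow> real"
  assumes "(\<lambda>k. \<bar>\<alpha> k\<bar>) summable_on UNIV"
  shows "(\<lambda>l. \<bar>\<alpha> (k - 2 * l)\<bar>) summable_on UNIV"
    and "(\<Sum>\<^sub>\<infinity>l. \<bar>\<alpha> (k - 2 * l)\<bar>) \<le> (\<Sum>\<^sub>\<infinity>k. \<bar>\<alpha> k\<bar>)"
proof -
  let ?h = "\<lambda>l::int. k - 2 * l"
  have inj: "inj ?h" by (simp add: inj_on_def)
  have s: "(\<lambda>k. \<bar>\<alpha> k\<bar>) summable_on range ?h"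
    using assms summable_on_subset_banach by blast
  with summable_on_reindex[OF inj, of "\<lambda>k. \<bar>\<alpha> k\<bar>"]
  show "(\<lambda>l. \<bar>\<alpha> (k - 2 * l)\<bar>) summable_on UNIV" by (simp add: o_def)
  have "(\<Sum>\<^sub>\<infinity>l. \<bar>\<alpha> (k - 2 * l)\<bar>) = infsum (\<lambda>k. \<bar>\<alpha> k\<bar>) (range ?h)"
    using infsum_reindex[OF inj, of "\<lambda>k. \<bar>\<alpha> k\<bar>"] by (simp add: o_def)
  also have "\<dots> \<le> (\<Sum>\<^sub>\<infinity>k. \<bar>\<alpha> k\<bar>)"
    by (rule infsum_mono_neutral[OF s assms]) auto
  finally show "(\<Sum>\<^sub>\<infinity>l. \<bar>\<alpha> (k - 2 * l)\<bar>) \<le> (\<Sum>\<^sub>\<infinity>k. \<bar>\<alpha> k\<bar>)" .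
qed

lemma subdivision_term_le:
  "norm (\<alpha> (k - 2 * l) * apply_bcontfun c l) \<le> \<bar>\<alpha> (k - 2 * l)\<bar> * norm c" for c :: linf
  using norm_bounded[of c l] by (simp add: abs_mult mult_left_mono)

lemma subdivision_summable:
  fixes c :: linf
  assumes "(\<lambda>k. \<bar>\<alpha> k\<bar>) summable_on UNIV"
  shows "(\<lambda>l. norm (\<alpha> (k - 2 * l) * apply_bcontfun c l)) summable_on UNIV"
    and "(\<lambda>l. \<alpha> (k - 2 * l) * apply_bcontfun c l) summable_on UNIV"
proof -
  have "(\<lambda>l. \<bar>\<alpha> (k - 2 * l)\<bar> * norm c) summable_on UNIV"
    by (intro summable_on_cmult_left mask_subsequence assms)
  then show 1: "(\<lambda>l. norm (\<alpha> (k - 2 * l) * apply_bcontfun c l)) summable_on UNIV"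
    using subdivision_term_le by (rule summable_on_comparison_test) auto
  show "(\<lambda>l. \<alpha> (k - 2 * l) * apply_bcontfun c l) summable_on UNIV"
    using abs_summable_summable[OF 1] .
qed

lemma subdivision_sum_le:
  fixes c :: linf
  assumes "(\<lambda>k. \<bar>\<alpha> k\<bar>) summable_on UNIV"
  shows "norm (\<Sum>\<^sub>\<infinity>l. \<alpha> (k - 2 * l) * apply_bcontfun c l) \<le> (\<Sum>\<^sub>\<infinity>k. \<bar>\<alpha> k\<bar>) * norm c"
proof -
  have "norm (\<Sum>\<^sub>\<infinity>l. \<alpha> (k - 2 * l) * apply_bcontfun c l)
      \<le> (\<Sum>\<^sub>\<infinity>l. norm (\<alpha> (k - 2 * l) * apply_bcontfun c l))"
    by (rule norm_infsum_bound) (rule subdivision_summable[OF assms])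
  also have "\<dots> \<le> (\<Sum>\<^sub>\<infinity>l. \<bar>\<alpha> (k - 2 * l)\<bar> * norm c)"
    by (intro infsum_mono subdivision_summable summable_on_cmult_left mask_subsequence
        subdivision_term_le assms)
  also have "\<dots> = (\<Sum>\<^sub>\<infinity>l. \<bar>\<alpha> (k - 2 * l)\<bar>) * norm c"
    by (intro infsum_cmult_left mask_subsequence assms)
  also have "\<dots> \<le> (\<Sum>\<^sub>\<infinity>k. \<bar>\<alpha> k\<bar>) * norm c"
    by (intro mult_right_mono mask_subsequence assms norm_ge_zero)
  finally show ?thesis .
qed

lemma apply_subdivision:
  fixes c :: linf
  assumes "(\<lambda>k. \<bar>\<alpha> k\<bar>) summable_on UNIV"
  shows "apply_bcontfun (subdivision \<alpha> c) k = (\<Sum>\<^sub>\<infinity>l. \<alpha> (k - 2 * l) * apply_bcontfun c l)"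
proof -
  have "(\<lambda>k. \<Sum>\<^sub>\<infinity>l. \<alpha> (k - 2 * l) * apply_bcontfun c l) \<in> bcontfun"
    by (rule bcontfun_normI[OF _ subdivision_sum_le[OF assms]]) simp
  then show ?thesis by (simp add: subdivision_def Bcontfun_inverse)
qed

lemma bounded_linear_subdivision:
  assumes "(\<lambda>k. \<bar>\<alpha> k\<bar>) summable_on UNIV"
  shows "bounded_linear (subdivision \<alpha>)"
proof (rule bounded_linear_intro)
  note [simp] = apply_subdivision[OF assms]
  note s = subdivision_summable(2)[OF assms]
  show "subdivision \<alpha> (x + y) = subdivision \<alpha> x + subdivision \<alpha> y" for x y
    by (rule bcontfun_eqI) (simp add: distrib_left infsum_add[OF s s])
  show "subdivision \<alpha> (r *\<^sub>R x) = r *\<^sub>R subdivision \<alpha> x" for r x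
    by (rule bcontfun_eqI) (simp add: mult.left_commute[of _ r] infsum_cmult_right s)
  show "norm (subdivision \<alpha> x) \<le> norm x * (\<Sum>\<^sub>\<infinity>k. \<bar>\<alpha> k\<bar>)" for x
    by (rule norm_bound) (use subdivision_sum_le[OF assms] in \<open>simp add: mult.commute\<close>)
qed

text \<open>
  A bound \<open>K\<close> for the norms of the powers with positive exponent only may be smaller than \<open>1\<close>, for
  example for the zero mask. Stability with constant \<open>K\<close> then fails, since the detail of the last
  level enters with the identity, the power with exponent \<open>0\<close>: take all other data zero. Such a bound
  therefore yields stability precisely when \<open>K \<ge> 1\<close>.
\<close>

end

theory Submission
  imports Defs
begin

text \<open>
  The subdivision operator \<open>S\<close> is linear, so the error \<open>e l = c l - c' l\<close> obeys the recursion of the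
  scheme itself, driven by the errors of the details. Solving this affine recursion (discrete
  variation of constants, \<open>affine_recursion_solution\<close>) gives
  \[ e_j = S^j e_0 + \sum_{l=1}^{j} S^{j-l} (d_l - d'_l). \]
  Each initial or detail error is thus hit by a single power of \<open>S\<close>, and \<open>K\<close> bounds the norm of every
  such power: the hypothesis on the powers covers the positive exponents, and \<open>K \<ge> 1\<close> the
  identity, which acts on the detail error of the last level. The triangle inequality concludes. The
  recursion is solved before norms are taken because estimating level by level with
  \<open>\<parallel>S\<parallel> \<le> K\<close> would only give the constant \<open>K ^ j\<close>, which depends on the number of levels.
\<close>

lemma bounded_linear_funpow:
  fixes T :: "'a::real_normed_vector \<Rightarrow> 'a" and n :: nat
  assumes "bounded_linear T"
  shows "bounded_linear (T ^^ n)"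
proof (induction n)
  case 0
  show ?case by (simp add: id_def bounded_linear_ident)
next
  case (Suc n)
  then show ?case using bounded_linear_compose[OF assms Suc] by (simp add: o_def)
qed

lemma affine_recursion_solution:
  fixes T :: "'a::real_vector \<Rightarrow> 'a" and e f :: "nat \<Rightarrow> 'a"
  assumes T: "linear T"
    and rec: "\<And>l. l \<in> {1..n} \<Longrightarrow> e l = T (e (l - 1)) + f l"
  shows "e n = (T ^^ n) (e 0) + (\<Sum>l=1..n. (T ^^ (n - l)) (f l))"
  using rec
proof (induction n)
  case 0
  show ?case by simp
next
  case (Suc n)
  have "e (Suc n) = T (e n) + f (Suc n)"
    using Suc.prems[of "Suc n"] by simp
  also have "e n = (T ^^ n) (e 0) + (\<Sum>l=1..n. (T ^^ (n - l)) (f l))"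
    using Suc.prems by (intro Suc.IH) simp
  also have "T \<dots> = (T ^^ Suc n) (e 0) + (\<Sum>l=1..n. (T ^^ (Suc n - l)) (f l))"
    by (simp add: linear_add[OF T] linear_sum[OF T] Suc_diff_le)
  finally show ?case by (simp add: add.assoc)
qed

lemma affine_recursion_norm_le:
  fixes T :: "'a::real_normed_vector \<Rightarrow> 'a" and e f :: "nat \<Rightarrow> 'a"
  assumes T: "linear T"
    and power: "\<And>i x. norm ((T ^^ i) x) \<le> K * norm x"
    and rec: "\<And>l. l \<in> {1..n} \<Longrightarrow> e l = T (e (l - 1)) + f l"
  shows "norm (e n) \<le> K * (norm (e 0) + (\<Sum>l=1..n. norm (f l)))"
proof -
  have "norm (e n) \<le> norm ((T ^^ n) (e 0)) + (\<Sum>l=1..n. norm ((T ^^ (n - l)) (f l)))"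
    by (subst affine_recursion_solution[of T n e f, OF T rec])
      (auto intro!: norm_triangle_mono norm_sum)
  also have "\<dots> \<le> K * norm (e 0) + (\<Sum>l=1..n. K * norm (f l))"
    by (intro add_mono sum_mono power)
  finally show ?thesis by (simp add: distrib_left sum_distrib_left)
qed

theorem theorem10:
  fixes \<alpha> :: "int \<Rightarrow> real" and K :: real and j :: nat
    and c c' d d' :: "nat \<Rightarrow> linf"
  assumes mask: "(\<lambda>k. \<bar>\<alpha> k\<bar>) summable_on UNIV"
    and K_ge_1: "K \<ge> 1"
    and power_bound: "(SUP i\<in>{1..}. ereal (onorm (subdivision \<alpha> ^^ i))) \<le> ereal K"
    and j: "j \<ge> 1"
    and rec: "\<And>l. l \<in> {1..j} \<Longrightarrow> c l = subdivision \<alpha> (c (l - 1)) + d l"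
    and rec': "\<And>l. l \<in> {1..j} \<Longrightarrow> c' l = subdivision \<alpha> (c' (l - 1)) + d' l"
  shows "norm (c j - c' j) \<le> K * (norm (c 0 - c' 0) + (\<Sum>l=1..j. norm (d l - d' l)))"
proof -
  let ?S = "subdivision \<alpha>"
  have bl: "bounded_linear ?S"
    by (rule bounded_linear_subdivision[OF mask])
  then have lin: "linear ?S"
    by (rule bounded_linear.linear)
  have power: "norm ((?S ^^ i) x) \<le> K * norm x" for i x
  proof (cases "i = 0")
    case True
    \<comment> \<open>the identity, for which the supremum over positive exponents says nothing\<close>
    then show ?thesis using mult_right_mono[OF K_ge_1 norm_ge_zero[of x]] by simp
  next
    case False
    then have "onorm (?S ^^ i) \<le> K"
      using power_bound by (simp add: SUP_le_iff)
    then show ?thesis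
      using onorm[OF bounded_linear_funpow[OF bl, of i], of x]
      by (meson mult_right_mono norm_ge_zero order_trans)
  qed
  have "c l - c' l = ?S (c (l - 1) - c' (l - 1)) + (d l - d' l)" if "l \<in> {1..j}" for l
    using rec[OF that] rec'[OF that] by (simp add: linear_diff[OF lin])
  from affine_recursion_norm_le[of ?S K j "\<lambda>l. c l - c' l" "\<lambda>l. d l - d' l", OF lin power this]
  show ?thesis .
qed

end
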